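(* Let $m\geq 3$ and let $n_1,\ldots,n_m$ be positive integers; set $n_{m+1}=n_1$. Then $$\sum_{k=-n_1}^{n_1}(-1)^k q^{(m-1)k^2+\binom{k}{2}}\prod_{i=1}^m {n_i+n_{i+1}\brack n_i+k} ={n_1+n_m\brack n_1}\sum_{\lambda}\prod_{i=1}^{m-2}q^{\lambda_i^2}{\lambda_{i-1}\brack \lambda_i}{n_{i+1}+n_{i+2}\brack n_{i+1}-\lambda_i},$$ where $\lambda_0=n_1$ and the sum on the right runs over all sequences $\lambda=(\lambda_1,\ldots,\lambda_{m-2})$ of nonnegative integers with $\lambda_0\geq\lambda_1\geq\cdots\geq\lambda_{m-2}$.
   Context: For an integer $n\ge 0$, $(q)_n=(1-q)(1-q^2)\cdots(1-q^n)$ (with $(q)_0=1$), and the convention $1/(q)_n=0$ for $n<0$ is used. The $q$-binomial coefficient is ${n\brack k}=\frac{(q)_n}{(q)_k(q)_{n-k}}$, so that ${n\brack k}=0$ if $k>n$ or $k<0$. *)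

theory Defs
  imports
    "HOL-Library.FuncSet"
    "HOL-Computational_Algebra.Computational_Algebra"
begin

definition qfac :: "'a::field \<Rightarrow> nat \<Rightarrow> 'a" where
  "qfac q n = (\<Prod>i=1..n. 1 - q ^ i)"

text \<open>
  The reciprocal of the \<open>q\<close>-factorial is taken at integer arguments, because it carries the
  convention \<open>1/(q)\<^sub>n = 0\<close> for \<open>n < 0\<close>.
\<close>

definition inv_qfac :: "'a::field \<Rightarrow> int \<Rightarrow> 'a" where
  "inv_qfac q n = (if n < 0 then 0 else 1 / qfac q (nat n))"

definition qbinom :: "'a::field \<Rightarrow> nat \<Rightarrow> int \<Rightarrow> 'a" where
  "qbinom q n k = qfac q n * inv_qfac q k * inv_qfac q (int n - k)"

text \<open>
  The base \<open>q\<close> ranges over all elements of a field for which no factor \<open>1 - q ^ i\<close> vanishes, so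
  that the quotients above are genuine. An indeterminate is such an element of the field of
  rational functions:
\<close>

definition generic_base :: "'a::field \<Rightarrow> bool" where
  "generic_base q \<longleftrightarrow> (\<forall>i\<ge>1. q ^ i \<noteq> 1)"

lemma generic_base_indeterminate:
  "generic_base (Fract [:0, 1:] 1 :: 'b::field poly fract)"
proof -
  have pow: "(Fract [:0, 1:] 1 :: 'b poly fract) ^ i = Fract (monom 1 i) 1" for i
    by (induction i) (simp_all add: One_fract_def monom_Suc)
  have "monom (1::'b) i \<noteq> 1" if "i \<ge> 1" for i
    using that by (metis degree_1 degree_monom_eq not_one_le_zero one_neq_zero)
  then show ?thesis
    by (simp add: generic_base_def pow One_fract_def eq_fract)
qed

text \<open>
  Sequences \<open>\<lambda>\<^sub>0 \<ge> \<lambda>\<^sub>1 \<ge> \<dots> \<ge> \<lambda>\<^sub>r\<close> of natural numbers with prescribed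
  \<open>\<lambda>\<^sub>0 = a\<close>; extensionality at indices above \<open>r\<close> makes each sequence occur exactly once.
\<close>

definition weakly_decreasing_seqs :: "nat \<Rightarrow> nat \<Rightarrow> (nat \<Rightarrow> nat) set" where
  "weakly_decreasing_seqs a r =
     {l \<in> {0..r} \<rightarrow>\<^sub>E UNIV. l 0 = a \<and> (\<forall>i\<in>{1..r}. l i \<le> l (i - 1))}"

lemma finite_weakly_decreasing_seqs: "finite (weakly_decreasing_seqs a r)"
proof (rule finite_subset)
  show "weakly_decreasing_seqs a r \<subseteq> {0..r} \<rightarrow>\<^sub>E {..a}"
  proof
    fix l assume l: "l \<in> weakly_decreasing_seqs a r"
    have "l i \<le> a" if "i \<le> r" for i
      using that
    proof (induction i)
      case 0
      then show ?case using l by (simp add: weakly_decreasing_seqs_def)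
    next
      case (Suc i)
      have "\<forall>j\<in>{1..r}. l j \<le> l (j - 1)"
        using l by (simp add: weakly_decreasing_seqs_def)
      then have "l (Suc i) \<le> l i"
        using Suc.prems by (metis atLeastAtMost_iff diff_Suc_1 le_add1 plus_1_eq_Suc)
      then show ?case using Suc by simp
    qed
    then show "l \<in> {0..r} \<rightarrow>\<^sub>E {..a}"
      using l by (auto simp: weakly_decreasing_seqs_def PiE_iff)
  qed
  show "finite ({0..r} \<rightarrow>\<^sub>E {..a})"
    by (simp add: finite_PiE)
qed

end

theory Submission
  imports Defs
begin

text \<open>
  Dividing out the factorials \<open>(q)\<^bsub>n\<^sub>i + n\<^sub>i\<^sub>+\<^sub>1\<^esub>\<close>, the left-hand side becomes a sum over \<open>k\<close> whose summand
  is a product of the symmetric factors \<open>1 / ((q)\<^bsub>a-k\<^esub> (q)\<^bsub>a+k\<^esub>)\<close> for \<open>a = n\<^sub>1, \<dots>, n\<^sub>m\<close>. The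
  \<open>q\<close>-Vandermonde convolution replaces \<open>q^(k\<^sup>2)\<close> times two such factors, for \<open>a\<close> and \<open>b\<close>, by a sum
  over \<open>l\<close> of single factors for \<open>l\<close>. Applied to \<open>n\<^sub>1\<close> and \<open>n\<^sub>2\<close>, this removes one index and produces
  the summation variable \<open>\<lambda>\<^sub>1\<close>; iterating produces the whole sequence \<open>\<lambda>\<close>. When a single factor is
  left, the sum over \<open>k\<close> is an instance of the finite \<open>q\<close>-binomial theorem and vanishes unless \<open>l = 0\<close>.
\<close>

section \<open>Factorials and binomial coefficients in base q\<close>

lemma qfac_nonzero: "generic_base q \<Longrightarrow> qfac q n \<noteq> 0"
  by (auto simp: qfac_def generic_base_def)

lemma qfac_0 [simp]: "qfac q 0 = 1"
  by (simp add: qfac_def)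

lemma qfac_Suc: "qfac q (Suc n) = qfac q n * (1 - q ^ Suc n)"
  by (simp add: qfac_def)

lemma inv_qfac_neg [simp]: "k < 0 \<Longrightarrow> inv_qfac q k = 0"
  by (simp add: inv_qfac_def)

lemma inv_qfac_of_nat [simp]: "inv_qfac q (int n) = 1 / qfac q n"
  by (simp add: inv_qfac_def)

lemma qbinom_eq_0 [simp]: "int n < k \<Longrightarrow> qbinom q n k = 0"
  by (simp add: qbinom_def)

lemma qbinom_of_nat:
  "k \<le> n \<Longrightarrow> qbinom q n (int k) = qfac q n / (qfac q k * qfac q (n - k))"
  by (simp add: qbinom_def flip: of_nat_diff)

lemma qbinom_0 [simp]: "generic_base q \<Longrightarrow> qbinom q n 0 = 1"
  using qbinom_of_nat[of 0 n q] by (simp add: qfac_nonzero)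

lemma qbinom_self [simp]: "generic_base q \<Longrightarrow> qbinom q n (int n) = 1"
  by (simp add: qbinom_of_nat qfac_nonzero)

text \<open>For k < n, over a common denominator, this is 1 - x y = (1 - y) + y (1 - x) with x =
  q^(k+1) and y = q^(n-k). For k > n the truncated exponent \<open>n - k\<close> does no harm, since
  all three binomials vanish.\<close>

lemma qbinom_Pascal:
  assumes "generic_base q"
  shows "qbinom q (Suc n) (int (Suc k)) =
         qbinom q n (int (Suc k)) + q ^ (n - k) * qbinom q n (int k)"
proof (cases "k < n")
  case True
  then obtain d where n: "n = Suc (k + d)"
    using less_imp_Suc_add by blast
  have nz: "1 - q ^ Suc k \<noteq> 0" "1 - q ^ Suc d \<noteq> 0"
    using assms unfolding generic_base_def by (metis One_nat_def Suc_le_mono eq_iff_diff_eq_0 le0)+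
  define x y where "x = q ^ Suc k" and "y = q ^ Suc d"
  have s: "q ^ Suc (Suc (k + d)) = x * y" "q ^ (n - k) = y"
    by (simp_all add: x_def y_def n power_add Suc_diff_le)
  have d: "Suc n - Suc k = Suc d" "n - Suc k = d" "n - k = Suc d"
    by (simp_all add: n)
  have nz': "1 - x \<noteq> 0" "1 - y \<noteq> 0"
    using nz by (simp_all only: x_def y_def not_False_eq_True)
  have f: "qfac q (Suc n) = qfac q n * (1 - x * y)" "qfac q (Suc k) = qfac q k * (1 - x)"
    "qfac q (Suc d) = qfac q d * (1 - y)"
    unfolding qfac_Suc by (simp_all only: n s(1) x_def y_def)
  have "qbinom q (Suc n) (int (Suc k)) =
      qfac q n * (1 - x * y) / (qfac q k * (1 - x) * (qfac q d * (1 - y)))"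
    using True by (subst qbinom_of_nat, simp, simp only: d f)
  moreover have "qbinom q n (int (Suc k)) = qfac q n / (qfac q k * (1 - x) * qfac q d)"
    using True by (subst qbinom_of_nat, simp, simp only: d f)
  moreover have "qbinom q n (int k) = qfac q n / (qfac q k * (qfac q d * (1 - y)))"
    using True by (subst qbinom_of_nat, simp, simp only: d f)
  moreover have "F * (1 - x * y) / (K * (1 - x) * (D * (1 - y))) =
      F / (K * (1 - x) * D) + y * (F / (K * (D * (1 - y))))" if "K \<noteq> 0" "D \<noteq> 0" for F K D
  proof -
    have "1 - x * y = (1 - y) + y * (1 - x)"
      by (simp add: algebra_simps)
    moreover have "F * (Y + y * X) / (K * X * (D * Y)) = F / (K * X * D) + y * (F / (K * (D * Y)))"
      if "X \<noteq> 0" "Y \<noteq> 0" for X Y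
      using that \<open>K \<noteq> 0\<close> \<open>D \<noteq> 0\<close> by (simp add: divide_simps) (simp add: algebra_simps)
    ultimately show ?thesis
      using nz' by metis
  qed
  ultimately show ?thesis
    using qfac_nonzero[OF assms] by (simp only: s not_False_eq_True)
next
  case False
  then consider "k = n" | "n < k" by linarith
  then show ?thesis
    by cases (use assms in \<open>simp_all only: qbinom_self, simp_all\<close>)
qed

lemma qbinom_symmetric: "k \<le> n \<Longrightarrow> qbinom q n (int (n - k)) = qbinom q n (int k)"
  by (simp only: qbinom_of_nat diff_le_self diff_diff_cancel mult.commute)

text \<open>The mirror image of \<open>qbinom_Pascal\<close> under the symmetry of the
  binomials.\<close>

lemma qbinom_Pascal':
  assumes "generic_base q"
  shows "qbinom q (Suc n) (int (Suc k)) =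
         q ^ Suc k * qbinom q n (int (Suc k)) + qbinom q n (int k)"
proof (cases "k < n")
  case True
  then have "qbinom q (Suc n) (int (Suc k)) = qbinom q (Suc n) (int (Suc (n - Suc k)))"
    by (subst qbinom_symmetric[symmetric]) (simp_all add: Suc_diff_Suc)
  also have "\<dots> = qbinom q n (int (n - k)) + q ^ Suc k * qbinom q n (int (n - Suc k))"
    using True by (subst qbinom_Pascal[OF assms]) (simp_all add: Suc_diff_Suc)
  finally show ?thesis
    using True by (simp only: qbinom_symmetric less_imp_le Suc_leI add.commute)
next
  case False
  then consider "k = n" | "n < k" by linarith
  then show ?thesis
    by cases (use assms in \<open>simp_all only: qbinom_self, simp_all\<close>)
qed

text \<open>Induction on \<open>a\<close>: Pascal's rule for upper index \<open>Suc a\<close> splits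
  the sum into the one for \<open>a\<close>, \<open>c\<close>, \<open>r\<close> and, after a shift
  of s, a multiple of the one for \<open>a\<close>, \<open>c - 1\<close>, \<open>r + 1\<close>.
  Pascal's rule on the right-hand side joins the two values. Lowering \<open>c\<close> while raising
  \<open>r\<close> keeps the upper index \<open>c + r\<close> fixed, hence both are
  generalised.\<close>

lemma qbinom_Vandermonde:
  assumes "generic_base q"
  shows "(\<Sum>s\<le>c. q ^ (s * (s + r)) * qbinom q a (int s) * qbinom q (c + r) (int (c - s))) =
         qbinom q (a + c + r) (int c)"
proof (induction a arbitrary: c r)
  case 0
  have "(\<Sum>s\<le>c. q ^ (s * (s + r)) * qbinom q 0 (int s) * qbinom q (c + r) (int (c - s))) =
        (\<Sum>s\<in>{0}. q ^ (s * (s + r)) * qbinom q 0 (int s) * qbinom q (c + r) (int (c - s)))"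
    by (rule sum.mono_neutral_right) auto
  then show ?case
    using assms by simp
next
  case (Suc a)
  show ?case
  proof (cases c)
    case 0
    then show ?thesis using assms by simp
  next
    case c: (Suc d)
    \<comment> \<open>The exponents agree for t <= a. For t > a, where \<open>a - t\<close> is
      truncated, both sides are 0.\<close>
    have e: "q ^ (Suc t * (Suc t + r)) * (q ^ (a - t) * qbinom q a (int t)) =
        q ^ Suc (a + r) * (q ^ (t * (t + Suc r)) * qbinom q a (int t))" for t
    proof (cases "t \<le> a")
      case True
      then have "Suc t * (Suc t + r) + (a - t) = Suc (a + r) + t * (t + Suc r)"
        by (simp add: algebra_simps)
      then show ?thesis
        by (simp only: mult.assoc[symmetric] power_add[symmetric])
    qed simp
    let ?g = "\<lambda>s. q ^ (s * (s + r)) * qbinom q a (int s) * qbinom q (c + r) (int (c - s))"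
    have "(\<Sum>s\<le>c. q ^ (s * (s + r)) * qbinom q (Suc a) (int s) * qbinom q (c + r) (int (c - s))) =
        qbinom q (c + r) (int c) +
        (\<Sum>t\<le>d. q ^ (Suc t * (Suc t + r)) * qbinom q (Suc a) (int (Suc t)) *
          qbinom q (c + r) (int (d - t)))"
      using assms unfolding c by (subst sum.atMost_Suc_shift) simp
    also have "\<dots> = qbinom q (c + r) (int c) +
        (\<Sum>t\<le>d. ?g (Suc t) + q ^ Suc (a + r) * (q ^ (t * (t + Suc r)) * qbinom q a (int t) *
          qbinom q (d + Suc r) (int (d - t))))"
    proof (intro arg_cong2[where f = "(+)"] sum.cong refl)
      fix t
      have "q ^ (Suc t * (Suc t + r)) * qbinom q (Suc a) (int (Suc t)) * qbinom q (c + r) (int (d - t))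
        = q ^ (Suc t * (Suc t + r)) * qbinom q a (int (Suc t)) * qbinom q (c + r) (int (d - t)) +
          q ^ (Suc t * (Suc t + r)) * (q ^ (a - t) * qbinom q a (int t)) * qbinom q (c + r) (int (d - t))"
        unfolding qbinom_Pascal[OF assms] by (simp only: distrib_left distrib_right)
      then show "q ^ (Suc t * (Suc t + r)) * qbinom q (Suc a) (int (Suc t)) * qbinom q (c + r) (int (d - t))
        = ?g (Suc t) + q ^ Suc (a + r) * (q ^ (t * (t + Suc r)) * qbinom q a (int t) *
          qbinom q (d + Suc r) (int (d - t)))"
        unfolding e by (simp add: c mult.assoc)
    qed
    also have "\<dots> = (\<Sum>s\<le>c. ?g s) + q ^ Suc (a + r) * (\<Sum>t\<le>d. q ^ (t * (t + Suc r)) *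
        qbinom q a (int t) * qbinom q (d + Suc r) (int (d - t)))"
      using assms unfolding c
      by (subst sum.atMost_Suc_shift) (simp add: sum.distrib sum_distrib_left)
    also have "\<dots> = qbinom q (a + c + r) (int (Suc d)) + q ^ Suc (a + r) * qbinom q (a + c + r) (int d)"
      unfolding Suc.IH by (simp add: c)
    also have "\<dots> = qbinom q (Suc a + c + r) (int c)"
      using qbinom_Pascal[OF assms, of "a + c + r" d] by (simp add: c)
    finally show ?thesis .
  qed
qed

section \<open>The Bailey step\<close>

lemma Bailey_step_nat:
  fixes k a b :: nat
  assumes "generic_base q"
  shows "q ^ k\<^sup>2 * qfac q (a + b) * (inv_qfac q (int a - int k) * inv_qfac q (int a + int k)) *
           (inv_qfac q (int b - int k) * inv_qfac q (int b + int k)) =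
         (\<Sum>l\<le>b. q ^ l\<^sup>2 * inv_qfac q (int a - int l) * inv_qfac q (int b - int l) *
           (inv_qfac q (int l - int k) * inv_qfac q (int l + int k)))"
proof (cases "k \<le> a \<and> k \<le> b")
  case False
  then have "(\<Sum>l\<le>b. q ^ l\<^sup>2 * inv_qfac q (int a - int l) * inv_qfac q (int b - int l) *
           (inv_qfac q (int l - int k) * inv_qfac q (int l + int k))) = 0"
    by (intro sum.neutral) (auto simp: inv_qfac_def)
  with False show ?thesis by auto
next
  case True
  \<comment> \<open>With l = s + k, A = a - k and C = b - k the sum becomes a q-Vandermonde sum with
    r = 2k, because (s + k)^2 = k^2 + s (s + 2k).\<close>
  then obtain A C where a: "a = A + k" and b: "b = C + k"
    by (metis add.commute le_Suc_ex)
  let ?f = "\<lambda>l. q ^ l\<^sup>2 * inv_qfac q (int a - int l) * inv_qfac q (int b - int l) *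
           (inv_qfac q (int l - int k) * inv_qfac q (int l + int k))"
  have nz: "qfac q n \<noteq> 0" for n
    using assms by (rule qfac_nonzero)
  have "(\<Sum>l\<le>b. ?f l) = (\<Sum>l\<in>{k..b}. ?f l)"
    by (rule sum.mono_neutral_right) auto
  also have "\<dots> = (\<Sum>s\<le>C. ?f (s + k))"
    by (rule sum.reindex_bij_witness[of _ "\<lambda>s. s + k" "\<lambda>l. l - k"]) (auto simp: b)
  also have "\<dots> = (\<Sum>s\<le>C. q ^ k\<^sup>2 / (qfac q A * qfac q (C + 2 * k)) *
      (q ^ (s * (s + 2 * k)) * qbinom q A (int s) * qbinom q (C + 2 * k) (int (C - s))))"
  proof (intro sum.cong refl)
    fix s assume "s \<in> {..C}"
    then have s: "C + 2 * k - (C - s) = s + 2 * k" "C - s \<le> C + 2 * k" "int C - int s = int (C - s)"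
      by auto
    have p: "q ^ (s + k)\<^sup>2 = q ^ k\<^sup>2 * q ^ (s * (s + 2 * k))"
      unfolding power_add[symmetric]
      by (rule arg_cong[where f = "power q"]) (simp add: power2_eq_square algebra_simps)
    have i: "int a - int (s + k) = int A - int s" "int b - int (s + k) = int C - int s"
      "int (s + k) - int k = int s" "int (s + k) + int k = int (s + 2 * k)"
      by (simp_all add: a b)
    show "?f (s + k) = q ^ k\<^sup>2 / (qfac q A * qfac q (C + 2 * k)) *
      (q ^ (s * (s + 2 * k)) * qbinom q A (int s) * qbinom q (C + 2 * k) (int (C - s)))"
      unfolding p i qbinom_of_nat[OF s(2)] s(1,3) inv_qfac_of_nat
      by (simp add: qbinom_def nz mult_ac)
  qed
  also have "\<dots> = q ^ k\<^sup>2 / (qfac q A * qfac q (C + 2 * k)) * qbinom q (A + C + 2 * k) (int C)"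
    by (simp only: sum_distrib_left[symmetric] qbinom_Vandermonde[OF assms])
  also have "\<dots> = q ^ k\<^sup>2 * qfac q (a + b) * (inv_qfac q (int a - int k) * inv_qfac q (int a + int k)) *
           (inv_qfac q (int b - int k) * inv_qfac q (int b + int k))"
  proof -
    have i: "int a - int k = int A" "int b - int k = int C" "int a + int k = int (A + 2 * k)"
      "int b + int k = int (C + 2 * k)" "a + b = A + C + 2 * k" "A + C + 2 * k - C = A + 2 * k"
      by (simp_all add: a b)
    show ?thesis
      unfolding i inv_qfac_of_nat by (subst qbinom_of_nat) (simp_all only: i, simp_all add: mult_ac)
  qed
  finally show ?thesis by simp
qed

text \<open>In the language of Bailey pairs relative to 1, this is the kernel that turns the alpha
  sequence, spread over positive and negative k, into the beta sequence.\<close>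

definition sym_factor :: "'a::field \<Rightarrow> int \<Rightarrow> nat \<Rightarrow> 'a" where
  "sym_factor q k a = inv_qfac q (int a - k) * inv_qfac q (int a + k)"

lemma sym_factor_uminus [simp]: "sym_factor q (- k) a = sym_factor q k a"
  by (simp add: sym_factor_def mult.commute)

lemma sym_factor_eq_0: "int a < \<bar>k\<bar> \<Longrightarrow> sym_factor q k a = 0"
  by (cases "k \<ge> 0") (auto simp: sym_factor_def)

text \<open>Both sides are even in \<open>k\<close>, which reduces the claim to natural
  \<open>k\<close>. Exchanging \<open>a\<close> and \<open>b\<close> makes the sum stop at
  \<open>a\<close>, as the condition on consecutive entries of lambda requires.\<close>

lemma Bailey_step:
  assumes "generic_base q"
  shows "q ^ (nat \<bar>k\<bar>)\<^sup>2 * qfac q (a + b) * sym_factor q k a * sym_factor q k b =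
         (\<Sum>l\<le>a. q ^ l\<^sup>2 * inv_qfac q (int a - int l) * inv_qfac q (int b - int l) *
           sym_factor q k l)"
proof -
  have "sym_factor q k = sym_factor q (int (nat \<bar>k\<bar>))"
    by (cases "k \<ge> 0") auto
  then show ?thesis
    using Bailey_step_nat[OF assms, of "nat \<bar>k\<bar>" b a]
    by (simp only: sym_factor_def mult_ac add.commute)
qed

section \<open>The alternating sum over a single symmetric factor\<close>

text \<open>Natural exponents throughout, since \<open>generic_base\<close> admits \<open>q = 0\<close>.\<close>

definition choose2 :: "int \<Rightarrow> nat" where
  "choose2 k = nat ((k * (k - 1)) div 2)"

lemma choose2_nonneg: "0 \<le> k * (k - 1)" for k :: int
  by (cases "k \<le> 0") (auto simp: mult_nonpos_nonpos)

lemma of_nat_choose2: "int (choose2 k) = (k * (k - 1)) div 2"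
  using choose2_nonneg[of k] by (simp add: choose2_def pos_imp_zdiv_nonneg_iff)

lemma choose2_add_1: "int (choose2 (k + 1)) = int (choose2 k) + k"
proof -
  have "(k + 1) * k = k * (k - 1) + 2 * k"
    by (simp add: algebra_simps)
  then show ?thesis
    by (simp add: of_nat_choose2)
qed

text \<open>For q nonzero this is, up to a power of q, the finite q-binomial theorem for the product
  of 1 - z q^i over i < n at z = q^(-l), where the factor with i = l vanishes. The induction on
  \<open>n\<close> avoids negative powers and so covers q = 0.\<close>

lemma alternating_qbinom_sum_eq_0:
  assumes "generic_base q" "l < n"
  shows "(\<Sum>j\<le>n. (-1) ^ j * q ^ choose2 (int j - int l) * qbinom q n (int j)) = 0"
  using assms(2)
proof (induction n arbitrary: l)
  case 0
  then show ?case by simp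
next
  case (Suc n)
  \<comment> \<open>For l > 0, the summand for \<open>n\<close> and l - 1. Moving the 1 to the other
    side keeps it meaningful at l = 0.\<close>
  let ?d = "\<lambda>j. (-1) ^ j * q ^ choose2 (int j + 1 - int l) * qbinom q n (int j)"
  have e: "q ^ choose2 (int j - int l) * q ^ j = q ^ l * q ^ choose2 (int j + 1 - int l)" for j
    unfolding power_add[symmetric]
    by (rule arg_cong[where f = "power q"])
       (use choose2_add_1[of "int j - int l"] in \<open>simp add: algebra_simps\<close>)
  have "(\<Sum>j\<le>Suc n. (-1) ^ j * q ^ choose2 (int j - int l) * qbinom q (Suc n) (int j)) =
     q ^ choose2 (- int l) + (\<Sum>j\<le>n. (-1) ^ Suc j * q ^ choose2 (int (Suc j) - int l) *
       (q ^ Suc j * qbinom q n (int (Suc j)) + qbinom q n (int j)))"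
    using assms(1) by (subst sum.atMost_Suc_shift) (simp only: qbinom_Pascal', simp)
  also have "\<dots> = (q ^ choose2 (- int l) + (\<Sum>j\<le>n. (-1) ^ Suc j * q ^ choose2 (int (Suc j) - int l) *
       (q ^ Suc j * qbinom q n (int (Suc j))))) - (\<Sum>j\<le>n. ?d j)"
    by (simp add: algebra_simps sum.distrib sum_negf sum_subtractf)
  also have "q ^ choose2 (- int l) + (\<Sum>j\<le>n. (-1) ^ Suc j * q ^ choose2 (int (Suc j) - int l) *
       (q ^ Suc j * qbinom q n (int (Suc j)))) =
     (\<Sum>j\<le>Suc n. (-1) ^ j * (q ^ choose2 (int j - int l) * q ^ j) * qbinom q n (int j))"
    using assms(1) by (subst sum.atMost_Suc_shift) (simp add: mult.assoc)
  also have "\<dots> = (\<Sum>j\<le>n. (-1) ^ j * (q ^ choose2 (int j - int l) * q ^ j) * qbinom q n (int j))"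
    by simp
  also have "\<dots> = q ^ l * (\<Sum>j\<le>n. ?d j)"
    unfolding e by (simp add: sum_distrib_left mult_ac)
  \<comment> \<open>The sum is (q^l - 1) times the shifted sum: the factor is 0 for l = 0, and
    otherwise the induction hypothesis for l - 1 applies.\<close>
  finally have rec: "(\<Sum>j\<le>Suc n. (-1) ^ j * q ^ choose2 (int j - int l) * qbinom q (Suc n) (int j)) =
    q ^ l * (\<Sum>j\<le>n. ?d j) - (\<Sum>j\<le>n. ?d j)" .
  show ?case
  proof (cases l)
    case 0
    show ?thesis unfolding rec by (simp add: 0)
  next
    case l: (Suc l')
    have "(\<Sum>j\<le>n. ?d j) = 0"
      using Suc.IH[of l'] Suc.prems by (simp add: l)
    then show ?thesis unfolding rec by simp
  qed
qed

text \<open>This is the unit Bailey pair. With k = j - l the symmetric factor is a binomial with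
  upper index 2l divided by \<open>qfac q (2 * l)\<close>, and l < 2l whenever l > 0.\<close>

lemma alternating_sym_factor_sum:
  assumes "generic_base q"
  shows "(\<Sum>k = - int l..int l. (-1) powi k * q ^ choose2 k * sym_factor q k l) = of_bool (l = 0)"
proof (cases "l = 0")
  case True
  then show ?thesis by (simp add: choose2_def sym_factor_def inv_qfac_def)
next
  case False
  have "(\<Sum>k = - int l..int l. (-1) powi k * q ^ choose2 k * sym_factor q k l) =
    (\<Sum>j\<le>2 * l. (-1) powi (int j - int l) * q ^ choose2 (int j - int l) * sym_factor q (int j - int l) l)"
    by (rule sum.reindex_bij_witness[of _ "\<lambda>j. int j - int l" "\<lambda>k. nat (k + int l)"]) auto
  also have "\<dots> = (\<Sum>j\<le>2 * l. (-1) ^ l / qfac q (2 * l) *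
      ((-1) ^ j * q ^ choose2 (int j - int l) * qbinom q (2 * l) (int j)))"
  proof (intro sum.cong refl)
    fix j
    have "(-1 :: 'a) powi (int j - int l) = (-1) ^ l * (-1) ^ j"
      by (simp add: power_int_diff minus_one_power_iff)
    moreover have "sym_factor q (int j - int l) l = qbinom q (2 * l) (int j) / qfac q (2 * l)"
      using qfac_nonzero[OF assms, of "2 * l"] by (simp add: sym_factor_def qbinom_def)
    ultimately show "(-1) powi (int j - int l) * q ^ choose2 (int j - int l) *
        sym_factor q (int j - int l) l = (-1) ^ l / qfac q (2 * l) *
        ((-1) ^ j * q ^ choose2 (int j - int l) * qbinom q (2 * l) (int j))"
      by simp
  qed
  also have "\<dots> = 0"
    using False by (simp only: sum_distrib_left[symmetric] alternating_qbinom_sum_eq_0[OF assms])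
      (simp add: alternating_qbinom_sum_eq_0[OF assms])
  finally show ?thesis using False by simp
qed

text \<open>After exchanging the sums, the inner range shrinks to |k| <= l because the symmetric
  factor vanishes beyond, so the inner sum has the original shape again. The weight \<open>h\<close>
  is left free to carry the sign, the remaining power of q and the remaining symmetric
  factors.\<close>

lemma Bailey_step_sum:
  assumes "generic_base q"
  shows "qfac q (a + b) * (\<Sum>k = - int a..int a. q ^ (nat \<bar>k\<bar>)\<^sup>2 * h k * sym_factor q k a * sym_factor q k b) =
    (\<Sum>l\<le>a. q ^ l\<^sup>2 * inv_qfac q (int a - int l) * inv_qfac q (int b - int l) *
      (\<Sum>k = - int l..int l. h k * sym_factor q k l))"
proof -
  have "qfac q (a + b) * (\<Sum>k = - int a..int a. q ^ (nat \<bar>k\<bar>)\<^sup>2 * h k * sym_factor q k a * sym_factor q k b) =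
    (\<Sum>k = - int a..int a. h k *
      (q ^ (nat \<bar>k\<bar>)\<^sup>2 * qfac q (a + b) * sym_factor q k a * sym_factor q k b))"
    by (simp add: sum_distrib_left mult_ac)
  also have "\<dots> = (\<Sum>l\<le>a. \<Sum>k = - int a..int a. h k *
      (q ^ l\<^sup>2 * inv_qfac q (int a - int l) * inv_qfac q (int b - int l) * sym_factor q k l))"
    unfolding Bailey_step[OF assms] sum_distrib_left by (rule sum.swap)
  also have "\<dots> = (\<Sum>l\<le>a. q ^ l\<^sup>2 * inv_qfac q (int a - int l) * inv_qfac q (int b - int l) *
      (\<Sum>k = - int a..int a. h k * sym_factor q k l))"
    by (simp add: sum_distrib_left mult_ac)
  also have "\<dots> = (\<Sum>l\<le>a. q ^ l\<^sup>2 * inv_qfac q (int a - int l) * inv_qfac q (int b - int l) *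
      (\<Sum>k = - int l..int l. h k * sym_factor q k l))"
    by (intro sum.cong refl arg_cong2[where f = "(*)"] sum.mono_neutral_right)
       (auto simp: sym_factor_eq_0)
  finally show ?thesis .
qed

section \<open>Sums over weakly decreasing sequences\<close>

lemma sum_weakly_decreasing_seqs_0:
  "(\<Sum>l\<in>weakly_decreasing_seqs a 0. h l) = h (\<lambda>i. if i = 0 then a else undefined)"
proof -
  have "weakly_decreasing_seqs a 0 = {\<lambda>i. if i = 0 then a else undefined}"
    by (auto simp: weakly_decreasing_seqs_def PiE_iff extensional_def fun_eq_iff)
  then show ?thesis by simp
qed

text \<open>Splits off the head: \<open>case_nat a l\<close> prepends \<open>a\<close> to a sequence
  starting at some b <= a.\<close>

lemma sum_weakly_decreasing_seqs_Suc:
  "(\<Sum>l\<in>weakly_decreasing_seqs a (Suc p). h l) =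
   (\<Sum>b\<le>a. \<Sum>l\<in>weakly_decreasing_seqs b p. h (case_nat a l))"
proof -
  have "(\<Sum>b\<le>a. \<Sum>l\<in>weakly_decreasing_seqs b p. h (case_nat a l)) =
      (\<Sum>(b, l)\<in>(SIGMA b:{..a}. weakly_decreasing_seqs b p). h (case_nat a l))"
    by (rule sum.Sigma) (auto simp: finite_weakly_decreasing_seqs)
  also have "\<dots> = (\<Sum>l\<in>weakly_decreasing_seqs a (Suc p). h l)"
  proof (rule sum.reindex_bij_witness[of _ "\<lambda>l. (l 1, \<lambda>i. l (Suc i))" "\<lambda>(b, l). case_nat a l"], goal_cases)
    case (1 x)
    then show ?case by (auto simp: weakly_decreasing_seqs_def)
  next
    case (2 x)
    then obtain b l where x: "x = (b, l)" and "b \<le> a" and l: "l \<in> extensional {0..p}" "l 0 = b"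
      "\<forall>i\<in>{1..p}. l i \<le> l (i - 1)"
      by (auto simp: weakly_decreasing_seqs_def PiE_iff)
    have "case_nat a l i \<le> case_nat a l (i - 1)" if i: "i \<in> {1..Suc p}" for i
    proof (cases "i = 1")
      case True
      then show ?thesis using l \<open>b \<le> a\<close> by simp
    next
      case False
      then obtain j where "i = Suc (Suc j)" "Suc j \<in> {1..p}"
        using i by (cases i; cases "i - 1") auto
      then show ?thesis using l(3) by fastforce
    qed
    then show ?case
      using l(1) by (auto simp: x weakly_decreasing_seqs_def PiE_iff extensional_def split: nat.splits)
  next
    case (3 l)
    then show ?case
      by (auto simp: weakly_decreasing_seqs_def fun_eq_iff split: nat.splits)
  next
    case (4 l)
    then have d: "\<forall>i\<in>{1..Suc p}. l i \<le> l (i - 1)" and "l 0 = a" "l \<in> extensional {0..Suc p}"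
      by (auto simp: weakly_decreasing_seqs_def PiE_iff)
    moreover have "l 1 \<le> l 0" using d by force
    moreover have "l (Suc i) \<le> l i" if "i \<le> p" for i
      using d that by force
    ultimately show ?case
      by (auto simp: weakly_decreasing_seqs_def PiE_iff extensional_def)
  next
    case (5 x)
    then show ?case by auto
  qed
  finally show ?thesis by simp
qed

section \<open>Iteration of the Bailey step\<close>

lemma prod_atLeast1_Suc:
  fixes g :: "nat \<Rightarrow> 'a::comm_monoid_mult"
  shows "(\<Prod>i=1..Suc p. g i) = g 1 * (\<Prod>i=1..p. g (Suc i))"
  by (induction p) (simp_all add: mult_ac)

text \<open>Here \<open>a\<close> stands for the first index and \<open>f 0\<close>, ...,
  \<open>f p\<close> for the others. Each Bailey step spends one of the p + 1 copies of q^(k^2),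
  removes \<open>f 0\<close> and replaces \<open>a\<close> by the next entry of lambda. The
  factorials in front are chosen so that the factors on the right come out as binomials and the base
  case equals 1.\<close>

lemma Bailey_chain:
  assumes "generic_base q"
  shows "qfac q (a + f 0) * qfac q a * qfac q (f p) *
    (\<Sum>k = - int a..int a. (-1) powi k * q ^ (Suc p * (nat \<bar>k\<bar>)\<^sup>2 + choose2 k) * sym_factor q k a *
       (\<Prod>i\<le>p. sym_factor q k (f i))) =
    (\<Sum>l\<in>weakly_decreasing_seqs a p. \<Prod>i=1..p. q ^ (l i)\<^sup>2 * qbinom q (l (i - 1)) (int (l i)) *
       inv_qfac q (int (f (i - 1)) - int (l i)) * inv_qfac q (int (f i) + int (l i)))"
proof (induction p arbitrary: a f)
  case 0
  \<comment> \<open>The last Bailey step leaves alternating sums over single symmetric factors, of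
    which only l = 0 survives.\<close>
  have "qfac q (a + f 0) *
    (\<Sum>k = - int a..int a. (-1) powi k * q ^ (Suc 0 * (nat \<bar>k\<bar>)\<^sup>2 + choose2 k) * sym_factor q k a *
       (\<Prod>i\<le>0. sym_factor q k (f i))) =
    (\<Sum>l\<le>a. q ^ l\<^sup>2 * inv_qfac q (int a - int l) * inv_qfac q (int (f 0) - int l) * of_bool (l = 0))"
    unfolding alternating_sym_factor_sum[OF assms, symmetric] Bailey_step_sum[OF assms, symmetric]
    by (simp add: power_add mult_ac)
  also have "\<dots> = (\<Sum>l\<in>{0}. q ^ l\<^sup>2 * inv_qfac q (int a - int l) * inv_qfac q (int (f 0) - int l) * of_bool (l = 0))"
    by (rule sum.mono_neutral_right) auto
  also have "\<dots> = 1 / (qfac q a * qfac q (f 0))"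
    by simp
  finally show ?case
    using qfac_nonzero[OF assms]
    by (simp only: sum_weakly_decreasing_seqs_0) (simp add: field_simps)
next
  case (Suc p)
  let ?G = "\<lambda>b. \<Sum>k = - int b..int b. (-1) powi k * q ^ (Suc p * (nat \<bar>k\<bar>)\<^sup>2 + choose2 k) *
      sym_factor q k b * (\<Prod>i\<le>p. sym_factor q k (f (Suc i)))"
  let ?H = "\<lambda>b. \<Sum>l\<in>weakly_decreasing_seqs b p. \<Prod>i=1..p. q ^ (l i)\<^sup>2 *
      qbinom q (l (i - 1)) (int (l i)) *
       inv_qfac q (int (f (Suc (i - 1))) - int (l i)) * inv_qfac q (int (f (Suc i)) + int (l i))"
  have nz: "qfac q n \<noteq> 0" for n
    using assms by (rule qfac_nonzero)
  have "qfac q (a + f 0) *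
    (\<Sum>k = - int a..int a. (-1) powi k * q ^ (Suc (Suc p) * (nat \<bar>k\<bar>)\<^sup>2 + choose2 k) * sym_factor q k a *
       (\<Prod>i\<le>Suc p. sym_factor q k (f i))) =
    qfac q (a + f 0) * (\<Sum>k = - int a..int a. q ^ (nat \<bar>k\<bar>)\<^sup>2 *
       ((-1) powi k * q ^ (Suc p * (nat \<bar>k\<bar>)\<^sup>2 + choose2 k) * (\<Prod>i\<le>p. sym_factor q k (f (Suc i)))) *
       sym_factor q k a * sym_factor q k (f 0))"
    by (simp only: prod.atMost_Suc_shift) (simp add: power_add mult_ac)
  also have "\<dots> = (\<Sum>b\<le>a. q ^ b\<^sup>2 * inv_qfac q (int a - int b) * inv_qfac q (int (f 0) - int b) * ?G b)"
    unfolding Bailey_step_sum[OF assms] by (simp add: mult_ac)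
  finally have "qfac q (a + f 0) * qfac q a * qfac q (f (Suc p)) *
    (\<Sum>k = - int a..int a. (-1) powi k * q ^ (Suc (Suc p) * (nat \<bar>k\<bar>)\<^sup>2 + choose2 k) * sym_factor q k a *
       (\<Prod>i\<le>Suc p. sym_factor q k (f i))) =
    qfac q a * qfac q (f (Suc p)) *
    (\<Sum>b\<le>a. q ^ b\<^sup>2 * inv_qfac q (int a - int b) * inv_qfac q (int (f 0) - int b) * ?G b)"
    by (simp only: mult_ac)
  \<comment> \<open>Prepares the induction hypothesis for \<open>b\<close> and the shifted
    \<open>f\<close>: the binomial replaces \<open>qfac q a\<close> by \<open>qfac q b\<close>, and
    the inserted \<open>qfac q (b + f (Suc 0))\<close> is cancelled by the reciprocal before
    it.\<close>
  also have "\<dots> = (\<Sum>b\<le>a. q ^ b\<^sup>2 * qbinom q a (int b) * inv_qfac q (int (f 0) - int b) *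
      inv_qfac q (int (f 1) + int b) *
      (qfac q (b + f (Suc 0)) * qfac q b * qfac q (f (Suc p)) * ?G b))"
    unfolding sum_distrib_left[of "qfac q a * qfac q (f (Suc p))"]
  proof (intro sum.cong refl)
    fix b
    have "inv_qfac q (int (f 1) + int b) * qfac q (b + f (Suc 0)) = 1"
      using nz by (simp add: add.commute flip: of_nat_add)
    moreover have "qbinom q a (int b) * qfac q b = qfac q a * inv_qfac q (int a - int b)"
      using nz by (simp add: qbinom_def)
    moreover have "A * z * (x * u * y * g) = x * B * y * w * (w' * c * z * g)"
      if "w * w' = 1" "B * c = A * u" for A B c u w w' x y z g :: 'a
    proof -
      have "x * B * y * w * (w' * c * z * g) = (w * w') * (B * c) * (x * y * z * g)"
        by (simp only: mult_ac)
      then show ?thesis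
        by (simp only: that) (simp add: mult_ac)
    qed
    ultimately show "qfac q a * qfac q (f (Suc p)) *
        (q ^ b\<^sup>2 * inv_qfac q (int a - int b) * inv_qfac q (int (f 0) - int b) * ?G b) =
      q ^ b\<^sup>2 * qbinom q a (int b) * inv_qfac q (int (f 0) - int b) *
      inv_qfac q (int (f 1) + int b) *
      (qfac q (b + f (Suc 0)) * qfac q b * qfac q (f (Suc p)) * ?G b)"
      by blast
  qed
  also have "\<dots> = (\<Sum>b\<le>a. q ^ b\<^sup>2 * qbinom q a (int b) * inv_qfac q (int (f 0) - int b) *
      inv_qfac q (int (f 1) + int b) * ?H b)"
    unfolding Suc.IH[of _ "\<lambda>i. f (Suc i)"] ..
  also have "\<dots> = (\<Sum>b\<le>a. \<Sum>l\<in>weakly_decreasing_seqs b p. \<Prod>i=1..Suc p. q ^ (case_nat a l i)\<^sup>2 *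
       qbinom q (case_nat a l (i - 1)) (int (case_nat a l i)) *
       inv_qfac q (int (f (i - 1)) - int (case_nat a l i)) * inv_qfac q (int (f i) + int (case_nat a l i)))"
    unfolding sum_distrib_left
  proof (intro sum.cong refl)
    fix b l assume l: "l \<in> weakly_decreasing_seqs b p"
    let ?u = "\<lambda>i. q ^ (case_nat a l i)\<^sup>2 * qbinom q (case_nat a l (i - 1)) (int (case_nat a l i)) *
       inv_qfac q (int (f (i - 1)) - int (case_nat a l i)) * inv_qfac q (int (f i) + int (case_nat a l i))"
    have "(\<Prod>i=1..Suc p. ?u i) = ?u 1 * (\<Prod>i=1..p. ?u (Suc i))"
      by (rule prod_atLeast1_Suc)
    moreover have "(\<Prod>i=1..p. ?u (Suc i)) = (\<Prod>i=1..p. q ^ (l i)\<^sup>2 *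
        qbinom q (l (i - 1)) (int (l i)) *
       inv_qfac q (int (f (Suc (i - 1))) - int (l i)) * inv_qfac q (int (f (Suc i)) + int (l i)))"
      by (intro prod.cong refl) (auto split: nat.splits)
    moreover have "l 0 = b"
      using l by (simp add: weakly_decreasing_seqs_def)
    ultimately show "q ^ b\<^sup>2 * qbinom q a (int b) * inv_qfac q (int (f 0) - int b) *
      inv_qfac q (int (f 1) + int b) * (\<Prod>i=1..p. q ^ (l i)\<^sup>2 *
        qbinom q (l (i - 1)) (int (l i)) *
       inv_qfac q (int (f (Suc (i - 1))) - int (l i)) * inv_qfac q (int (f (Suc i)) + int (l i)))
      = (\<Prod>i=1..Suc p. ?u i)"
      by simp
  qed
  also have "\<dots> = (\<Sum>l\<in>weakly_decreasing_seqs a (Suc p). \<Prod>i=1..Suc p. q ^ (l i)\<^sup>2 *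
       qbinom q (l (i - 1)) (int (l i)) *
       inv_qfac q (int (f (i - 1)) - int (l i)) * inv_qfac q (int (f i) + int (l i)))"
    by (simp only: sum_weakly_decreasing_seqs_Suc)
  finally show ?case .
qed

section \<open>The cyclic product and the final assembly\<close>

lemma prod_qbinom_cyclic:
  fixes n :: "nat \<Rightarrow> nat"
  assumes "n (m + 1) = n 1"
  shows "(\<Prod>i=1..m. qbinom q (n i + n (i + 1)) (int (n i) + k)) =
    (\<Prod>i=1..m. qfac q (n i + n (i + 1))) * (\<Prod>i=1..m. sym_factor q k (n i))"
proof -
  \<comment> \<open>Each binomial contributes one half of the symmetric factor of n_i and one half
    of that of its successor; shifting the second halves around the cycle reunites them.\<close>
  have "(\<Prod>i=1..m. inv_qfac q (int (n (i + 1)) - k)) = (\<Prod>i=1..m. inv_qfac q (int (n i) - k))"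
  proof (cases m)
    case (Suc r)
    then show ?thesis
      using assms prod_atLeast1_Suc[of "\<lambda>i. inv_qfac q (int (n i) - k)" r]
      by (simp add: mult.commute)
  qed simp
  then show ?thesis
    by (simp add: qbinom_def sym_factor_def prod.distrib add_diff_add mult_ac)
qed

theorem theorem1p2:
  fixes q :: "'a::field" and m :: nat and n :: "nat \<Rightarrow> nat"
  assumes "generic_base q"
    and "m \<ge> 3"
    and "\<forall>i\<in>{1..m}. n i > 0"
    and "n (m + 1) = n 1"
  shows
    "(\<Sum>k = - int (n 1)..int (n 1).
        (-1) powi k * q powi ((int m - 1) * k\<^sup>2 + (k * (k - 1)) div 2) *
        (\<Prod>i=1..m. qbinom q (n i + n (i + 1)) (int (n i) + k)))
     = qbinom q (n 1 + n m) (int (n 1)) *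
       (\<Sum>l\<in>weakly_decreasing_seqs (n 1) (m - 2).
          \<Prod>i=1..m - 2.
            q ^ (l i)\<^sup>2 * qbinom q (l (i - 1)) (int (l i)) *
            qbinom q (n (i + 1) + n (i + 2)) (int (n (i + 1)) - int (l i)))"
proof -
  define p where "p = m - 2"
  have m: "m = Suc (Suc p)"
    using assms(2) by (simp add: p_def)
  \<comment> \<open>Lists n_2, ..., n_m as \<open>f 0\<close>, ..., \<open>f p\<close>.\<close>
  define f where "f i = n (i + 2)" for i
  \<comment> \<open>The numerators of the binomials inside the sum over lambda. Of the two other
    factorials of the cyclic product, the one for n_1 + n_2 enters \<open>Bailey_chain\<close> and
    the one for n_1 + n_m the outer binomial.\<close>
  define M where "M = (\<Prod>i=1..p. qfac q (n (i + 1) + n (i + 2)))"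
  have nz: "qfac q n \<noteq> 0" for n
    using assms(1) by (rule qfac_nonzero)
  have expo: "q powi ((int m - 1) * k\<^sup>2 + (k * (k - 1)) div 2) =
      q ^ (Suc p * (nat \<bar>k\<bar>)\<^sup>2 + choose2 k)" for k
  proof -
    have "(int m - 1) * k\<^sup>2 + (k * (k - 1)) div 2 = int (Suc p * (nat \<bar>k\<bar>)\<^sup>2 + choose2 k)"
      by (simp add: m of_nat_choose2 algebra_simps)
    then show ?thesis
      by (simp only: power_int_of_nat)
  qed
  have shift2: "(\<Prod>i=1..m. g i) = g 1 * (\<Prod>i\<le>p. g (i + 2))" for g :: "nat \<Rightarrow> 'a"
    unfolding m by (induction p) (simp_all add: mult_ac)
  have "(\<Prod>i=1..m. qfac q (n i + n (i + 1))) = qfac q (n 1 + n 2) * M * qfac q (n 1 + n m)"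
  proof -
    have "(\<Prod>i=1..m. qfac q (n i + n (i + 1))) =
        (\<Prod>i=1..Suc p. qfac q (n i + n (i + 1))) * qfac q (n 1 + n m)"
      using assms(4) by (simp add: m add.commute)
    also have "(\<Prod>i=1..Suc p. qfac q (n i + n (i + 1))) = qfac q (n 1 + n 2) * M"
      unfolding M_def
      by (subst prod_atLeast1_Suc) (simp add: numeral_2_eq_2)
    finally show ?thesis .
  qed
  then have "(\<Prod>i=1..m. qbinom q (n i + n (i + 1)) (int (n i) + k)) =
      qfac q (n 1 + n 2) * M * qfac q (n 1 + n m) *
      (sym_factor q k (n 1) * (\<Prod>i\<le>p. sym_factor q k (f i)))" for k
    by (simp only: prod_qbinom_cyclic[OF assms(4)] shift2[of "\<lambda>i. sym_factor q k (n i)"] f_def)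
  then have "(\<Sum>k = - int (n 1)..int (n 1).
        (-1) powi k * q powi ((int m - 1) * k\<^sup>2 + (k * (k - 1)) div 2) *
        (\<Prod>i=1..m. qbinom q (n i + n (i + 1)) (int (n i) + k))) =
      M * qfac q (n 1 + n m) * (qfac q (n 1 + n 2) * (\<Sum>k = - int (n 1)..int (n 1).
        (-1) powi k * q ^ (Suc p * (nat \<bar>k\<bar>)\<^sup>2 + choose2 k) * sym_factor q k (n 1) *
       (\<Prod>i\<le>p. sym_factor q k (f i))))"
    by (simp only: expo sum_distrib_left mult_ac)
  \<comment> \<open>Inserting the factorials of n_1 and n_m completes both the outer binomial and
    the prefactor of \<open>Bailey_chain\<close>.\<close>
  also have "\<dots> = qfac q (n 1 + n m) / (qfac q (n 1) * qfac q (n m)) *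
     (M * (qfac q (n 1 + f 0) * qfac q (n 1) * qfac q (f p) * (\<Sum>k = - int (n 1)..int (n 1).
        (-1) powi k * q ^ (Suc p * (nat \<bar>k\<bar>)\<^sup>2 + choose2 k) * sym_factor q k (n 1) *
       (\<Prod>i\<le>p. sym_factor q k (f i)))))"
    using nz by (simp add: f_def m numeral_2_eq_2)
  also have "\<dots> = qbinom q (n 1 + n m) (int (n 1)) *
      (\<Sum>l\<in>weakly_decreasing_seqs (n 1) p. M * (\<Prod>i=1..p. q ^ (l i)\<^sup>2 *
       qbinom q (l (i - 1)) (int (l i)) *
       inv_qfac q (int (f (i - 1)) - int (l i)) * inv_qfac q (int (f i) + int (l i))))"
    unfolding Bailey_chain[OF assms(1)] by (subst qbinom_of_nat) (simp_all add: sum_distrib_left)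
  also have "\<dots> = qbinom q (n 1 + n m) (int (n 1)) *
       (\<Sum>l\<in>weakly_decreasing_seqs (n 1) p.
          \<Prod>i=1..p.
            q ^ (l i)\<^sup>2 * qbinom q (l (i - 1)) (int (l i)) *
            qbinom q (n (i + 1) + n (i + 2)) (int (n (i + 1)) - int (l i)))"
    unfolding M_def prod.distrib[symmetric]
  proof (rule arg_cong2[where f = "(*)"], rule refl, intro sum.cong prod.cong refl)
    fix l :: "nat \<Rightarrow> nat" and i :: nat
    assume "i \<in> {1..p}"
    then have "f (i - 1) = n (i + 1)"
      by (simp add: f_def)
    \<comment> \<open>The complementary lower index is n_(i+2) + lambda_i, that is
      \<open>f i + l i\<close>.\<close>
    moreover have "qbinom q (n (i + 1) + n (i + 2)) (int (n (i + 1)) - int (l i)) =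
        qfac q (n (i + 1) + n (i + 2)) * inv_qfac q (int (n (i + 1)) - int (l i)) *
        inv_qfac q (int (f i) + int (l i))"
      by (simp add: qbinom_def f_def)
    ultimately show "qfac q (n (i + 1) + n (i + 2)) *
        (q ^ (l i)\<^sup>2 * qbinom q (l (i - 1)) (int (l i)) *
         inv_qfac q (int (f (i - 1)) - int (l i)) * inv_qfac q (int (f i) + int (l i))) =
       q ^ (l i)\<^sup>2 * qbinom q (l (i - 1)) (int (l i)) *
       qbinom q (n (i + 1) + n (i + 2)) (int (n (i + 1)) - int (l i))"
      by (simp only: mult_ac)
  qed
  finally show ?thesis
    by (simp only: p_def)
qed

end
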